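(* Let $\alpha\in]0;1[$ be a fixed constant, let $\sigma_0^2>0$, and let $\tilde\Upsilon$ be the test of $H_0:\sigma^2=\sigma_0^2$ versus $H_1:\sigma^2>\sigma_0^2$ which rejects $H_0$ if $$\tilde S\ \geq\ \hat z_\alpha:=\frac{\sigma_0^2}{n-1}\,q_{\chi^2_{n-1},\,1-\alpha}.$$ Then the test $\tilde\Upsilon$ is of Type I error $\alpha$, i.e. $\mathbb{P}_{\sigma_0^2}(\tilde S\geq\hat z_\alpha)=\alpha$, and therefore it is of level $\alpha$. Let $\beta\in]0;1[$ be a constant such that $1-\beta\geq\alpha$. For all $\sigma^2>0$ such that $$\sigma^2\ \geq\ \sigma_0^2\,\frac{q_{\chi^2_{n-1},\,1-\alpha}}{q_{\chi^2_{n-1},\,\beta}},$$ the test $\tilde\Upsilon$ satisfies $\mathbb{P}_{\sigma^2}(\tilde\Upsilon\text{ accepts }H_0)\leq\beta$. This condition on $\sigma^2$ is necessary and sufficient for $\mathbb{P}_{\sigma^2}(\tilde\Upsilon\text{ accepts }H_0)\leq\beta$.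
   Context: Consider the one-dimensional SDE $dX_t=\theta f_t\,dt+\sigma\,dW_t$, $X_0=x_0$, $t>0$, where $\theta\in\mathbb{R}$ is an unknown scalar parameter, $f_t$ is a known deterministic real function of time (integrable on $[0,T]$), $\sigma$ is a constant diffusion coefficient and $W$ is a one-dimensional Brownian motion. The process is observed at times $i\Delta$, $i=0,\dots,n$, with $n\geq2$, fixed $\Delta>0$, $n\Delta=T$, and $\sum_{i=1}^n\left(\int_{(i-1)\Delta}^{i\Delta}f_s\,ds\right)^2>0$. $\mathbb{P}_{\sigma^2}$ denotes the probability when the squared diffusion coefficient equals $\sigma^2$. The mean square estimator of $\theta$ is $$\hat\theta=\arg\min_\theta\sum_{i=1}^n\left(X_{i\Delta}-X_{(i-1)\Delta}-\theta\int_{(i-1)\Delta}^{i\Delta}f_s\,ds\right)^2.$$ The increments centered around the estimated drift are $$\hat\xi_i=\frac{X_{i\Delta}-X_{(i-1)\Delta}-\hat\theta\int_{(i-1)\Delta}^{i\Delta}f_s\,ds}{\sqrt\Delta},\quad \hat\xi=(\hat\xi_1,\dots,\hat\xi_n)^t.$$ Let $Z=(Z_1,\dots,Z_n)^t$ with $Z_i=\frac1{\sqrt\Delta}\int_{(i-1)\Delta}^{i\Delta}f_s\,ds$, and $H=Z(Z^tZ)^{-1}Z^t$. Let $C$ be a real matrix such that $(CC^t)^+=I-H$, where $A^+$ is the Moore–Penrose inverse of $A$. The test statistic is $\tilde S=\frac1{n-1}\|C^t\hat\xi\|^2$ (Euclidean norm). $q_{\chi^2_{m},\beta}$ is the quantile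 of order $\beta$ of the central chi-squared distribution with $m$ degrees of freedom. A test accepts $H_0$ when it does not reject it; level $\alpha$ means that the probability of rejecting under $H_0$ is at most $\alpha$. *)

theory Defs
  imports "HOL-Probability.Probability" "Jordan_Normal_Form.Matrix"
begin

text \<open>
  Matrices and vectors are those of \<^theory>\<open>Jordan_Normal_Form.Matrix\<close>, indexed from 0, so entry
  \<open>i\<close> of a vector of length \<open>n\<close> belongs to the observation interval number \<open>Suc i\<close>.
\<close>

no_notation vec_nth (infixl "$" 90)
no_notation inner (infixl "\<bullet>" 70)
hide_const (open) Finite_Cartesian_Product.vec Finite_Cartesian_Product.mat
hide_type (open) Finite_Cartesian_Product.vec


section \<open>Brownian motion and the stochastic differential equation\<close>

definition brownian_motion :: "'a measure \<Rightarrow> (real \<Rightarrow> 'a \<Rightarrow> real) \<Rightarrow> bool" where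
  "brownian_motion M W \<longleftrightarrow>
     prob_space M \<and>
     (\<forall>t\<ge>0. W t \<in> borel_measurable M) \<and>
     (AE \<omega> in M. W 0 \<omega> = 0) \<and>
     (AE \<omega> in M. continuous_on {0..} (\<lambda>t. W t \<omega>)) \<and>
     (\<forall>s t. 0 \<le> s \<and> s < t \<longrightarrow>
        distributed M lborel (\<lambda>\<omega>. W t \<omega> - W s \<omega>) (normal_density 0 (sqrt (t - s)))) \<and>
     (\<forall>(m::nat) (t::nat \<Rightarrow> real). 0 \<le> t 0 \<and> (\<forall>i<m. t i < t (Suc i)) \<longrightarrow>
        prob_space.indep_vars M (\<lambda>_. borel) (\<lambda>i \<omega>. W (t (Suc i)) \<omega> - W (t i) \<omega>) {..<m})"

text \<open>
  \<open>X\<close> solves \<open>dX = \<theta> f dt + \<sigma> dW\<close>, \<open>X\<^sub>0 = x0\<close> on \<open>[0,T]\<close>. A stochastic differential equation stands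
  for its integrated form, and the stochastic integral of the constant \<open>\<sigma>\<close> over \<open>[0,t]\<close> is
  \<open>\<sigma> W\<^sub>t\<close>.
\<close>

definition sde_solution ::
  "'a measure \<Rightarrow> (real \<Rightarrow> 'a \<Rightarrow> real) \<Rightarrow> (real \<Rightarrow> 'a \<Rightarrow> real) \<Rightarrow>
   (real \<Rightarrow> real) \<Rightarrow> real \<Rightarrow> real \<Rightarrow> real \<Rightarrow> real \<Rightarrow> bool" where
  "sde_solution M W X f T x0 \<theta> \<sigma> \<longleftrightarrow>
     brownian_motion M W \<and>
     (\<forall>t\<in>{0..T}. X t \<in> borel_measurable M) \<and>
     (AE \<omega> in M. \<forall>t\<in>{0..T}.
        X t \<omega> = x0 + \<theta> * (LINT s:{0..t}|lebesgue. f s) + \<sigma> * W t \<omega>)"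


section \<open>Chi-squared distribution and quantiles\<close>

text \<open>The law of the sum of the squares of \<open>m\<close> independent standard normal variables.\<close>

definition chi_squared :: "nat \<Rightarrow> real measure" where
  "chi_squared m =
     distr (PiM {..<m} (\<lambda>_. density lborel std_normal_density)) borel (\<lambda>x. \<Sum>i<m. (x i)\<^sup>2)"

definition quantile :: "real measure \<Rightarrow> real \<Rightarrow> real" where
  "quantile D \<beta> = Inf {x. \<beta> \<le> cdf D x}"


section \<open>Moore-Penrose inverse\<close>

definition moore_penrose :: "real mat \<Rightarrow> real mat \<Rightarrow> bool" where
  "moore_penrose A B \<longleftrightarrow>
     B \<in> carrier_mat (dim_col A) (dim_row A) \<and>
     A * B * A = A \<and> B * A * B = B \<and> (A * B)\<^sup>T = A * B \<and> (B * A)\<^sup>T = B * A"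

lemma moore_penrose_unique:
  assumes "moore_penrose A B" "moore_penrose A B'"
  shows "B = B'"
proof -
  define m n where "m = dim_row A" and "n = dim_col A"
  have A: "A \<in> carrier_mat m n" unfolding m_def n_def by (rule carrier_matI) (rule refl)+
  have B: "B \<in> carrier_mat n m" and ABA: "A * B * A = A" and BAB: "B * A * B = B"
    and ABt: "(A * B)\<^sup>T = A * B" and BAt: "(B * A)\<^sup>T = B * A"
    using assms(1) unfolding moore_penrose_def m_def n_def by blast+
  have B': "B' \<in> carrier_mat n m" and AB'A: "A * B' * A = A" and B'AB': "B' * A * B' = B'"
    and AB't: "(A * B')\<^sup>T = A * B'" and B'At: "(B' * A)\<^sup>T = B' * A"
    using assms(2) unfolding moore_penrose_def m_def n_def by blast+
  note AB = mult_carrier_mat[OF A B] and BA = mult_carrier_mat[OF B A]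
    and AB' = mult_carrier_mat[OF A B'] and B'A = mult_carrier_mat[OF B' A]
  have "A * B' * (A * B) = A * B"
    by (simp only: assoc_mult_mat[OF AB' A B, symmetric] AB'A)
  moreover have "A * B * (A * B') = A * B'"
    by (simp only: assoc_mult_mat[OF AB A B', symmetric] ABA)
  moreover have "(A * B * (A * B'))\<^sup>T = A * B' * (A * B)"
    by (simp only: transpose_mult[OF AB AB'] ABt AB't)
  ultimately have 1: "A * B = A * B'" by (simp only: AB't)
  have "B * A * (B' * A) = B * A"
    unfolding assoc_mult_mat[OF B A B'A] by (simp only: assoc_mult_mat[OF A B' A, symmetric] AB'A)
  moreover have "B' * A * (B * A) = B' * A"
    unfolding assoc_mult_mat[OF B' A BA] by (simp only: assoc_mult_mat[OF A B A, symmetric] ABA)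
  moreover have "(B' * A * (B * A))\<^sup>T = B * A * (B' * A)"
    by (simp only: transpose_mult[OF B'A BA] BAt B'At)
  ultimately have 2: "B * A = B' * A" by (simp only: B'At)
  have "B = B' * A * B" unfolding 2[symmetric] BAB ..
  also have "\<dots> = B' * A * B'" by (simp only: assoc_mult_mat[OF B' A B] 1 assoc_mult_mat[OF B' A B'])
  finally show ?thesis by (simp only: B'AB')
qed


section \<open>The estimator, the centered increments and the test\<close>

definition drift_increment :: "(real \<Rightarrow> real) \<Rightarrow> real \<Rightarrow> nat \<Rightarrow> real" where
  "drift_increment f \<Delta> i = (LINT s:{(real i - 1) * \<Delta>..real i * \<Delta>}|lebesgue. f s)"

text \<open>In what follows \<open>x\<close> is one path of the observed process.\<close>

definition mean_square_estimator ::
  "(real \<Rightarrow> real) \<Rightarrow> real \<Rightarrow> nat \<Rightarrow> (real \<Rightarrow> real) \<Rightarrow> real" where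
  "mean_square_estimator f \<Delta> n x =
     arg_min (\<lambda>\<theta>. \<Sum>i=1..n. (x (real i * \<Delta>) - x ((real i - 1) * \<Delta>)
                              - \<theta> * drift_increment f \<Delta> i)\<^sup>2) (\<lambda>_. True)"

definition centered_increments ::
  "(real \<Rightarrow> real) \<Rightarrow> real \<Rightarrow> nat \<Rightarrow> (real \<Rightarrow> real) \<Rightarrow> real vec" where
  "centered_increments f \<Delta> n x =
     vec n (\<lambda>i. (x (real (Suc i) * \<Delta>) - x ((real (Suc i) - 1) * \<Delta>)
                 - mean_square_estimator f \<Delta> n x * drift_increment f \<Delta> (Suc i)) / sqrt \<Delta>)"

definition drift_vector :: "(real \<Rightarrow> real) \<Rightarrow> real \<Rightarrow> nat \<Rightarrow> real vec" where
  "drift_vector f \<Delta> n = vec n (\<lambda>i. drift_increment f \<Delta> (Suc i) / sqrt \<Delta>)"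

text \<open>\<open>Z (Z\<^sup>T Z)\<^sup>-\<^sup>1 Z\<^sup>T\<close>, where the 1-by-1 matrix \<open>Z\<^sup>T Z\<close> is identified with the scalar \<open>Z \<bullet> Z\<close>.\<close>

definition hat_matrix :: "(real \<Rightarrow> real) \<Rightarrow> real \<Rightarrow> nat \<Rightarrow> real mat" where
  "hat_matrix f \<Delta> n =
     (let Z = drift_vector f \<Delta> n
      in inverse (Z \<bullet> Z) \<cdot>\<^sub>m (mat_of_cols n [Z] * (mat_of_cols n [Z])\<^sup>T))"

definition euclidean_norm :: "real vec \<Rightarrow> real" where
  "euclidean_norm v = L2_set (\<lambda>i. v $ i) {..<dim_vec v}"

definition test_statistic ::
  "(real \<Rightarrow> real) \<Rightarrow> real \<Rightarrow> nat \<Rightarrow> real mat \<Rightarrow> (real \<Rightarrow> real) \<Rightarrow> real" where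
  "test_statistic f \<Delta> n C x =
     (euclidean_norm (C\<^sup>T *\<^sub>v centered_increments f \<Delta> n x))\<^sup>2 / (real n - 1)"

definition critical_value :: "nat \<Rightarrow> real \<Rightarrow> real \<Rightarrow> real" where
  "critical_value n v0 \<alpha> = v0 / (real n - 1) * quantile (chi_squared (n - 1)) (1 - \<alpha>)"

text \<open>Here \<open>v0\<close> is the squared diffusion coefficient under the null hypothesis.\<close>

definition test_rejects ::
  "(real \<Rightarrow> real) \<Rightarrow> real \<Rightarrow> nat \<Rightarrow> real mat \<Rightarrow> real \<Rightarrow> real \<Rightarrow> (real \<Rightarrow> real) \<Rightarrow> bool" where
  "test_rejects f \<Delta> n C v0 \<alpha> x \<longleftrightarrow> test_statistic f \<Delta> n C x \<ge> critical_value n v0 \<alpha>"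

abbreviation test_accepts ::
  "(real \<Rightarrow> real) \<Rightarrow> real \<Rightarrow> nat \<Rightarrow> real mat \<Rightarrow> real \<Rightarrow> real \<Rightarrow> (real \<Rightarrow> real) \<Rightarrow> bool" where
  "test_accepts f \<Delta> n C v0 \<alpha> x \<equiv> \<not> test_rejects f \<Delta> n C v0 \<alpha> x"

end

theory Submission
  imports Defs
begin

text \<open>
  Put \<open>P = I - H\<close>. It is an orthogonal projection, hence its own Moore-Penrose inverse, so
  \<open>C C\<^sup>T = P\<close>. The centered increments are orthogonal to \<open>Z\<close>, so
  \<open>(n - 1) S = |P Y|\<^sup>2\<close> for the normalised increments \<open>Y = \<theta> Z + \<sigma> G\<close>, where \<open>G\<close> is standard Gaussian
  in dimension \<open>n\<close>. Since \<open>P Z = 0\<close>, this is \<open>\<sigma>\<^sup>2 |P G|\<^sup>2\<close>, and \<open>|P G|\<^sup>2\<close> is chi-squared with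
  \<open>n - 1\<close> degrees of freedom by rotation invariance. The distribution function of that law is
  continuous and strictly increasing on \<open>[0, \<infinity>)\<close>, so comparing probabilities amounts to comparing
  quantiles.
\<close>

section \<open>Gaussian projections and the chi-squared law\<close>

abbreviation std_normal :: "real measure" where
  "std_normal \<equiv> density lborel std_normal_density"

lemma prob_space_std_normal: "prob_space std_normal"
  by (rule prob_space_normal_density) simp

interpretation std_normal: prob_space std_normal
  by (rule prob_space_std_normal)

interpretation std_normal2: pair_prob_space std_normal std_normal ..

section \<open>Test functions and rotation invariance in the plane\<close>

lemma measure_eqI_nn_integral:
  assumes sets: "sets M = sets N"
    and eq: "\<And>F. F \<in> borel_measurable N \<Longrightarrow> (\<integral>\<^sup>+x. F x \<partial>M) = (\<integral>\<^sup>+x. F x \<partial>N)"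
  shows "M = N"
proof (rule measure_eqI[OF sets])
  fix A assume "A \<in> sets M"
  then show "emeasure M A = emeasure N A"
    using eq[of "indicator A"] sets by (simp add: nn_integral_indicator)
qed

text \<open>If \<open>c\<close> is nonzero, the rotation is undone by two one-dimensional
  substitutions, one variable at a time, whose Jacobians \<open>1 / \<bar>c\<bar>\<close> and
  \<open>\<bar>c\<bar>\<close> cancel. If \<open>c = 0\<close>, it is a swap of the axes combined
  with reflections.\<close>

lemma nn_integral_lborel_rotation:
  fixes F :: "real \<Rightarrow> real \<Rightarrow> ennreal"
  assumes [measurable]: "case_prod F \<in> borel_measurable (borel \<Otimes>\<^sub>M borel)"
    and cs: "c\<^sup>2 + s\<^sup>2 = 1"
  shows "(\<integral>\<^sup>+x. \<integral>\<^sup>+y. F (c * x + s * y) (c * y - s * x) \<partial>lborel \<partial>lborel) =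
         (\<integral>\<^sup>+x. \<integral>\<^sup>+y. F x y \<partial>lborel \<partial>lborel)"
proof (cases "c = 0")
  case True
  then have s: "s \<noteq> 0" "\<bar>s\<bar> = 1" using cs by (auto simp: power2_eq_1_iff)
  have "(\<integral>\<^sup>+x. \<integral>\<^sup>+y. F (s * y) (- s * x) \<partial>lborel \<partial>lborel) =
        (\<integral>\<^sup>+x. \<integral>\<^sup>+y. F y (- s * x) \<partial>lborel \<partial>lborel)"
    using s by (subst (2) nn_integral_real_affine[where t=0 and c=s]) auto
  also have "\<dots> = (\<integral>\<^sup>+x. \<integral>\<^sup>+y. F y x \<partial>lborel \<partial>lborel)"
    using s by (subst (3) nn_integral_real_affine[where t=0 and c="- s"]) auto
  also have "\<dots> = (\<integral>\<^sup>+x. \<integral>\<^sup>+y. F x y \<partial>lborel \<partial>lborel)"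
    by (rule lborel_pair.Fubini') measurable
  finally show ?thesis using True by simp
next
  case False
  have inner: "(\<integral>\<^sup>+x. F (c * x + s * y) (c * y - s * x) \<partial>lborel) =
     ennreal (1 / \<bar>c\<bar>) * (\<integral>\<^sup>+u. F u ((y - s * u) / c) \<partial>lborel)" for y
  proof -
    \<comment> \<open>For fixed \<open>y\<close> the new variable is
      \<open>u = c * x + s * y\<close>, that is, \<open>x = - s * y / c + 1 / c * u\<close>.\<close>
    have "(\<integral>\<^sup>+x. F (c * x + s * y) (c * y - s * x) \<partial>lborel) =
      ennreal \<bar>1 / c\<bar> * (\<integral>\<^sup>+u. F (c * (- s * y / c + 1 / c * u) + s * y)
         (c * y - s * (- s * y / c + 1 / c * u)) \<partial>lborel)"
      using False by (intro nn_integral_real_affine) auto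
    moreover have "c * (- s * y / c + 1 / c * u) + s * y = u" for u
      using False by (simp add: field_simps)
    moreover have "c * y - s * (- s * y / c + 1 / c * u) = (y - s * u) / c" for u
    proof -
      have "c * y - s * (- s * y / c + 1 / c * u) = ((c\<^sup>2 + s\<^sup>2) * y - s * u) / c"
        using False by (simp add: field_simps power2_eq_square)
      then show ?thesis using cs by simp
    qed
    ultimately show ?thesis by simp
  qed
  \<comment> \<open>Now \<open>u\<close> is fixed and \<open>y = s * u + c * v\<close>.\<close>
  have outer: "(\<integral>\<^sup>+y. F u ((y - s * u) / c) \<partial>lborel) = ennreal \<bar>c\<bar> * (\<integral>\<^sup>+v. F u v \<partial>lborel)" for u
    using False by (subst nn_integral_real_affine[where t="s * u" and c=c]) auto
  have "(\<integral>\<^sup>+x. \<integral>\<^sup>+y. F (c * x + s * y) (c * y - s * x) \<partial>lborel \<partial>lborel) =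
        (\<integral>\<^sup>+y. \<integral>\<^sup>+x. F (c * x + s * y) (c * y - s * x) \<partial>lborel \<partial>lborel)"
    by (rule lborel_pair.Fubini'[symmetric]) measurable
  also have "\<dots> = ennreal (1 / \<bar>c\<bar>) * (\<integral>\<^sup>+y. \<integral>\<^sup>+u. F u ((y - s * u) / c) \<partial>lborel \<partial>lborel)"
    unfolding inner by (rule nn_integral_cmult) measurable
  also have "(\<integral>\<^sup>+y. \<integral>\<^sup>+u. F u ((y - s * u) / c) \<partial>lborel \<partial>lborel) =
     (\<integral>\<^sup>+u. \<integral>\<^sup>+y. F u ((y - s * u) / c) \<partial>lborel \<partial>lborel)"
    by (rule lborel_pair.Fubini') measurable
  also have "\<dots> = ennreal \<bar>c\<bar> * (\<integral>\<^sup>+u. \<integral>\<^sup>+v. F u v \<partial>lborel \<partial>lborel)"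
    unfolding outer by (rule nn_integral_cmult) measurable
  also have "ennreal (1 / \<bar>c\<bar>) * (ennreal \<bar>c\<bar> * (\<integral>\<^sup>+u. \<integral>\<^sup>+v. F u v \<partial>lborel \<partial>lborel)) =
     (\<integral>\<^sup>+u. \<integral>\<^sup>+v. F u v \<partial>lborel \<partial>lborel)"
    using False by (simp add: mult.assoc[symmetric] ennreal_mult''[symmetric])
  finally show ?thesis .
qed

text \<open>The joint density \<open>\<phi>\<close> depends only on the squared radius, which a
  rotation preserves. It can therefore be absorbed into the integrand of the Lebesgue
  version.\<close>

lemma nn_integral_std_normal_rotation:
  fixes F :: "real \<Rightarrow> real \<Rightarrow> ennreal"
  assumes [measurable]: "case_prod F \<in> borel_measurable (borel \<Otimes>\<^sub>M borel)"
    and cs: "c\<^sup>2 + s\<^sup>2 = 1"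
  shows "(\<integral>\<^sup>+x. \<integral>\<^sup>+y. F (c * x + s * y) (c * y - s * x) \<partial>std_normal \<partial>std_normal) =
         (\<integral>\<^sup>+x. \<integral>\<^sup>+y. F x y \<partial>std_normal \<partial>std_normal)"
proof -
  define \<phi> where "\<phi> x y = std_normal_density x * std_normal_density y" for x y
  have \<phi>: "\<phi> x y = exp (- (x\<^sup>2 + y\<^sup>2) / 2) / (2 * pi)" for x y
    by (simp add: \<phi>_def std_normal_density_def exp_add[symmetric] field_simps)
  have "(c * x + s * y)\<^sup>2 + (c * y - s * x)\<^sup>2 = (c\<^sup>2 + s\<^sup>2) * (x\<^sup>2 + y\<^sup>2)" for x y
    by (simp add: power2_eq_square algebra_simps)
  then have rot: "\<phi> (c * x + s * y) (c * y - s * x) = \<phi> x y" for x y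
    by (simp add: \<phi> cs)
  have [measurable]: "case_prod \<phi> \<in> borel_measurable (borel \<Otimes>\<^sub>M borel)"
    unfolding \<phi>_def by measurable
  have dens: "(\<integral>\<^sup>+x. \<integral>\<^sup>+y. G x y \<partial>std_normal \<partial>std_normal) =
      (\<integral>\<^sup>+x. \<integral>\<^sup>+y. ennreal (\<phi> x y) * G x y \<partial>lborel \<partial>lborel)"
    if [measurable]: "case_prod G \<in> borel_measurable (borel \<Otimes>\<^sub>M borel)" for G
    by (simp add: nn_integral_density \<phi>_def ennreal_mult mult.assoc nn_integral_cmult)
  have "(\<integral>\<^sup>+x. \<integral>\<^sup>+y. F (c * x + s * y) (c * y - s * x) \<partial>std_normal \<partial>std_normal) =
     (\<integral>\<^sup>+x. \<integral>\<^sup>+y. ennreal (\<phi> (c * x + s * y) (c * y - s * x)) *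
        F (c * x + s * y) (c * y - s * x) \<partial>lborel \<partial>lborel)"
    by (subst dens) (simp_all add: rot)
  also have "\<dots> = (\<integral>\<^sup>+x. \<integral>\<^sup>+y. ennreal (\<phi> x y) * F x y \<partial>lborel \<partial>lborel)"
    by (rule nn_integral_lborel_rotation[OF _ cs, of "\<lambda>x y. ennreal (\<phi> x y) * F x y"]) measurable
  also have "\<dots> = (\<integral>\<^sup>+x. \<integral>\<^sup>+y. F x y \<partial>std_normal \<partial>std_normal)"
    by (subst dens) simp_all
  finally show ?thesis .
qed

section \<open>The chi-squared law as an iterated Gaussian integral\<close>

lemma sets_chi_squared [simp, measurable_cong]: "sets (chi_squared m) = sets borel"
  by (simp add: chi_squared_def)

lemma space_chi_squared [simp]: "space (chi_squared m) = UNIV"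
  by (simp add: chi_squared_def)

lemma prob_space_PiM_std_normal: "prob_space (PiM I (\<lambda>_. std_normal))"
  by (intro prob_space_PiM prob_space_std_normal)

lemma prob_space_chi_squared: "prob_space (chi_squared m)"
proof -
  interpret prob_space "PiM {..<m} (\<lambda>_. std_normal)" by (rule prob_space_PiM_std_normal)
  show ?thesis unfolding chi_squared_def by (intro prob_space_distr) measurable
qed

text \<open>Splitting off the last coordinate is what makes induction on the dimension possible: the
  product law is the image of a pair law under appending coordinate \<open>m\<close>, and Tonelli
  applies.\<close>

lemma nn_integral_PiM_std_normal_Suc:
  assumes [measurable]: "F \<in> borel_measurable (PiM {..<Suc m} (\<lambda>_. std_normal))"
  shows "(\<integral>\<^sup>+X. F X \<partial>PiM {..<Suc m} (\<lambda>_. std_normal)) =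
    (\<integral>\<^sup>+x. \<integral>\<^sup>+X. F (X(m := x)) \<partial>PiM {..<m} (\<lambda>_. std_normal) \<partial>std_normal)"
proof -
  interpret P: prob_space "PiM {..<m} (\<lambda>_. std_normal)" by (rule prob_space_PiM_std_normal)
  have meas [measurable]: "(\<lambda>(x, X). X(m := x)) \<in> std_normal \<Otimes>\<^sub>M PiM {..<m} (\<lambda>_. std_normal) \<rightarrow>\<^sub>M
      PiM {..<Suc m} (\<lambda>_. std_normal)"
    unfolding lessThan_Suc by measurable
  have [measurable]: "(\<lambda>(x, X). F (X(m := x))) \<in>
      borel_measurable (std_normal \<Otimes>\<^sub>M PiM {..<m} (\<lambda>_. std_normal))"
    using measurable_compose[OF meas assms] by (simp add: split_beta')
  have "(\<integral>\<^sup>+X. F X \<partial>PiM {..<Suc m} (\<lambda>_. std_normal)) =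
    (\<integral>\<^sup>+X. F X \<partial>distr (std_normal \<Otimes>\<^sub>M PiM {..<m} (\<lambda>_. std_normal))
      (PiM {..<Suc m} (\<lambda>_. std_normal)) (\<lambda>(x, X). X(m := x)))"
    unfolding lessThan_Suc by (subst distr_pair_PiM_eq_PiM) (auto intro: prob_space_std_normal)
  also have "\<dots> = (\<integral>\<^sup>+p. (case p of (x, X) \<Rightarrow> F (X(m := x)))
      \<partial>(std_normal \<Otimes>\<^sub>M PiM {..<m} (\<lambda>_. std_normal)))"
    by (subst nn_integral_distr) (auto intro!: nn_integral_cong)
  also have "\<dots> = (\<integral>\<^sup>+x. \<integral>\<^sup>+X. F (X(m := x)) \<partial>PiM {..<m} (\<lambda>_. std_normal) \<partial>std_normal)"
    by (subst P.nn_integral_fst[symmetric]) simp_all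
  finally show ?thesis .
qed

lemma nn_integral_chi_squared:
  assumes [measurable]: "F \<in> borel_measurable borel"
  shows "(\<integral>\<^sup>+t. F t \<partial>chi_squared m) =
    (\<integral>\<^sup>+X. F (\<Sum>i<m. (X i)\<^sup>2) \<partial>PiM {..<m} (\<lambda>_. std_normal))"
  unfolding chi_squared_def by (subst nn_integral_distr) auto

lemma nn_integral_chi_squared_0:
  assumes "F \<in> borel_measurable borel"
  shows "(\<integral>\<^sup>+q. F q \<partial>chi_squared 0) = F 0"
  using assms
  by (subst nn_integral_chi_squared) (simp_all add: PiM_empty nn_integral_count_space_finite)

text \<open>The last square is independent of the sum of the others. This convolution step drives
  the projection argument, the absence of atoms and the positivity of intervals.\<close>

lemma nn_integral_chi_squared_Suc:
  assumes [measurable]: "F \<in> borel_measurable borel"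
  shows "(\<integral>\<^sup>+t. F t \<partial>chi_squared (Suc m)) =
    (\<integral>\<^sup>+x. \<integral>\<^sup>+t. F (t + x\<^sup>2) \<partial>chi_squared m \<partial>std_normal)"
proof -
  have "(\<integral>\<^sup>+t. F t \<partial>chi_squared (Suc m)) = (\<integral>\<^sup>+x. \<integral>\<^sup>+X.
      F (\<Sum>i<Suc m. ((X(m := x)) i)\<^sup>2) \<partial>PiM {..<m} (\<lambda>_. std_normal) \<partial>std_normal)"
    by (subst nn_integral_chi_squared[OF assms], subst nn_integral_PiM_std_normal_Suc) simp_all
  also have "\<dots> = (\<integral>\<^sup>+x. \<integral>\<^sup>+X. F ((\<Sum>i<m. (X i)\<^sup>2) + x\<^sup>2) \<partial>PiM {..<m} (\<lambda>_. std_normal) \<partial>std_normal)"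
    by simp
  also have "\<dots> = (\<integral>\<^sup>+x. \<integral>\<^sup>+t. F (t + x\<^sup>2) \<partial>chi_squared m \<partial>std_normal)"
    by (subst nn_integral_chi_squared) simp_all
  finally show ?thesis .
qed

text \<open>\<open>c\<close> and the last entry of \<open>u\<close> are the cosine and sine of the
  rotation used in the induction below; \<open>v\<close> is the direction of the remaining
  entries.\<close>

lemma unit_vector_split:
  fixes u :: "nat \<Rightarrow> real"
  assumes "(\<Sum>i<Suc (Suc m). (u i)\<^sup>2) = 1"
  obtains c v where "(\<Sum>i<Suc m. (v i)\<^sup>2) = 1" "\<And>i. i < Suc m \<Longrightarrow> u i = c * v i"
    "c\<^sup>2 + (u (Suc m))\<^sup>2 = 1"
proof (cases "(\<Sum>i<Suc m. (u i)\<^sup>2) = 0")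
  case True
  then have "u i = 0" if "i < Suc m" for i
    using that by (subst (asm) sum_nonneg_eq_0_iff) auto
  \<comment> \<open>The leading entries of \<open>u\<close> determine no direction here, so
    \<open>v\<close> is chosen as the first axis, with \<open>c = 0\<close>.\<close>
  moreover have "(\<Sum>i<Suc m. (if i = 0 then 1 else 0 :: real)\<^sup>2) = 1"
    by (simp add: if_distrib[of "\<lambda>x. x\<^sup>2"] cong: if_cong)
  ultimately show ?thesis
    using True assms that[of "\<lambda>i. if i = 0 then 1 else 0" 0] by simp
next
  case False
  define c where "c = sqrt (\<Sum>i<Suc m. (u i)\<^sup>2)"
  have c2: "c\<^sup>2 = (\<Sum>i<Suc m. (u i)\<^sup>2)"
    unfolding c_def by (rule real_sqrt_pow2) (rule sum_nonneg, simp)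
  with False have c: "c \<noteq> 0" by auto
  have "(\<Sum>i<Suc m. (u i / c)\<^sup>2) = 1"
    using c by (simp only: power_divide sum_divide_distrib[symmetric] c2[symmetric]) simp
  then show ?thesis
    using c c2 assms by (intro that[of "\<lambda>i. u i / c" c]) auto
qed

text \<open>By induction on the dimension: a rotation in the plane spanned by the last axis and the
  projection of \<open>u\<close> onto the other axes turns the direction of that projection into \<open>u\<close>; the
  residual direction contributes one further squared standard normal variable.\<close>

lemma nn_integral_residual_projection:
  fixes u :: "nat \<Rightarrow> real" and F :: "real \<Rightarrow> real \<Rightarrow> ennreal"
  assumes "(\<Sum>i<Suc m. (u i)\<^sup>2) = 1"
    and [measurable]: "case_prod F \<in> borel_measurable (borel \<Otimes>\<^sub>M borel)"
  shows "(\<integral>\<^sup>+X. F ((\<Sum>i<Suc m. (X i)\<^sup>2) - (\<Sum>i<Suc m. u i * X i)\<^sup>2) (\<Sum>i<Suc m. u i * X i)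
      \<partial>PiM {..<Suc m} (\<lambda>_. std_normal)) =
    (\<integral>\<^sup>+w. \<integral>\<^sup>+q. F q w \<partial>chi_squared m \<partial>std_normal)"
  using assms
proof (induction m arbitrary: u F)
  case 0
  note [measurable] = \<open>case_prod F \<in> borel_measurable (borel \<Otimes>\<^sub>M borel)\<close>
  have u: "(u 0)\<^sup>2 = 1" using 0 by simp
  have "(\<integral>\<^sup>+X. F ((\<Sum>i<Suc 0. (X i)\<^sup>2) - (\<Sum>i<Suc 0. u i * X i)\<^sup>2) (\<Sum>i<Suc 0. u i * X i)
      \<partial>PiM {..<Suc 0} (\<lambda>_. std_normal)) = (\<integral>\<^sup>+x. F 0 (u 0 * x) \<partial>std_normal)"
    by (subst nn_integral_PiM_std_normal_Suc)
       (simp_all add: PiM_empty nn_integral_count_space_finite power_mult_distrib u)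
  \<comment> \<open>Here \<open>u 0\<close> is 1 or -1. A dummy variable \<open>y\<close> lets the
    planar rotation lemma with sine 0 absorb the sign.\<close>
  also have "\<dots> = (\<integral>\<^sup>+x. \<integral>\<^sup>+y. F 0 (u 0 * x + 0 * y) \<partial>std_normal \<partial>std_normal)"
    by (simp add: std_normal.emeasure_space_1[simplified])
  also have "\<dots> = (\<integral>\<^sup>+x. \<integral>\<^sup>+y. F 0 x \<partial>std_normal \<partial>std_normal)"
    using nn_integral_std_normal_rotation[of "\<lambda>x y. F 0 x" "u 0" 0] u by simp
  also have "\<dots> = (\<integral>\<^sup>+x. F 0 x \<partial>std_normal)"
    by (simp add: std_normal.emeasure_space_1[simplified])
  finally show ?case by (simp add: nn_integral_chi_squared_0)
next
  case (Suc m)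
  note [measurable] = \<open>case_prod F \<in> borel_measurable (borel \<Otimes>\<^sub>M borel)\<close>
  interpret chi: prob_space "chi_squared m" by (rule prob_space_chi_squared)
  interpret pair_sigma_finite std_normal "chi_squared m" ..
  let ?s = "u (Suc m)"
  obtain c v where v: "(\<Sum>i<Suc m. (v i)\<^sup>2) = 1" and uv: "\<And>i. i < Suc m \<Longrightarrow> u i = c * v i"
    and cs: "c\<^sup>2 + ?s\<^sup>2 = 1"
    using unit_vector_split[OF Suc.prems(1)] by blast
  let ?Q = "\<lambda>X. (\<Sum>i<Suc m. (X i)\<^sup>2) - (\<Sum>i<Suc m. v i * X i)\<^sup>2"
  let ?U = "\<lambda>X. \<Sum>i<Suc m. v i * X i :: real"
  have U: "(\<Sum>i<Suc (Suc m). u i * (X(Suc m := x)) i) = c * ?U X + ?s * x" for X and x :: real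
  proof -
    have "(\<Sum>i<Suc m. u i * (X(Suc m := x)) i) = (\<Sum>i<Suc m. c * (v i * X i))"
      by (rule sum.cong) (auto simp: uv)
    then show ?thesis by (subst sum.lessThan_Suc) (simp only: sum_distrib_left fun_upd_same)
  qed
  have S: "(\<Sum>i<Suc (Suc m). ((X(Suc m := x)) i)\<^sup>2) = (\<Sum>i<Suc m. (X i)\<^sup>2) + x\<^sup>2" for X and x :: real
  proof -
    have "(\<Sum>i<Suc m. ((X(Suc m := x)) i)\<^sup>2) = (\<Sum>i<Suc m. (X i)\<^sup>2)"
      by (rule sum.cong) auto
    then show ?thesis by (subst sum.lessThan_Suc) (simp only: fun_upd_same)
  qed
  \<comment> \<open>With \<open>w\<close> the projection on \<open>v\<close>, rotating the pair
    \<open>(w, x)\<close> preserves \<open>w\<^sup>2 + x\<^sup>2\<close>. Removing the square along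
    \<open>u\<close> thus leaves the old residual \<open>a - w\<^sup>2\<close> plus the square of
    the other rotated coordinate.\<close>
  have Q: "a + x\<^sup>2 - (c * w + ?s * x)\<^sup>2 = a - w\<^sup>2 + (c * x - ?s * w)\<^sup>2" for a w x
  proof -
    have "x\<^sup>2 + w\<^sup>2 - (c * w + ?s * x)\<^sup>2 = (c\<^sup>2 + ?s\<^sup>2) * (x\<^sup>2 + w\<^sup>2) - (c * w + ?s * x)\<^sup>2"
      by (simp only: cs) simp
    also have "\<dots> = (c * x - ?s * w)\<^sup>2" by (simp add: power2_eq_square algebra_simps)
    finally show ?thesis by linarith
  qed
  have integrand: "(\<lambda>X. F ((\<Sum>i<Suc (Suc m). (X i)\<^sup>2) - (\<Sum>i<Suc (Suc m). u i * X i)\<^sup>2)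
      (\<Sum>i<Suc (Suc m). u i * X i)) \<in> borel_measurable (PiM {..<Suc (Suc m)} (\<lambda>_. std_normal))"
    by measurable
  have "(\<integral>\<^sup>+X. F ((\<Sum>i<Suc (Suc m). (X i)\<^sup>2) - (\<Sum>i<Suc (Suc m). u i * X i)\<^sup>2)
      (\<Sum>i<Suc (Suc m). u i * X i) \<partial>PiM {..<Suc (Suc m)} (\<lambda>_. std_normal)) =
    (\<integral>\<^sup>+x. \<integral>\<^sup>+X. F (?Q X + (c * x - ?s * ?U X)\<^sup>2) (c * ?U X + ?s * x)
      \<partial>PiM {..<Suc m} (\<lambda>_. std_normal) \<partial>std_normal)"
    unfolding nn_integral_PiM_std_normal_Suc[OF integrand] U S Q ..
  \<comment> \<open>The induction hypothesis for \<open>v\<close>, at each fixed \<open>x\<close>,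
    replaces residual and projection by independent \<open>q\<close> and \<open>w\<close>.\<close>
  also have "\<dots> = (\<integral>\<^sup>+x. \<integral>\<^sup>+w. \<integral>\<^sup>+q. F (q + (c * x - ?s * w)\<^sup>2) (c * w + ?s * x)
      \<partial>chi_squared m \<partial>std_normal \<partial>std_normal)"
    by (intro nn_integral_cong
        Suc.IH[OF v, of "\<lambda>q w. F (q + (c * _ - ?s * w)\<^sup>2) (c * w + ?s * _)"]) measurable
  also have "\<dots> = (\<integral>\<^sup>+w. \<integral>\<^sup>+x. \<integral>\<^sup>+q. F (q + (c * x - ?s * w)\<^sup>2) (c * w + ?s * x)
      \<partial>chi_squared m \<partial>std_normal \<partial>std_normal)"
    by (rule std_normal2.Fubini') measurable
  \<comment> \<open>After the exchange of integrals \<open>(w, x)\<close> is a planar Gaussian pair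
    in the order of the rotation lemma, which turns it into the projection on \<open>u\<close> and
    one fresh coordinate.\<close>
  also have "\<dots> = (\<integral>\<^sup>+w. \<integral>\<^sup>+x. \<integral>\<^sup>+q. F (q + x\<^sup>2) w \<partial>chi_squared m \<partial>std_normal \<partial>std_normal)"
    by (rule nn_integral_std_normal_rotation[OF _ cs,
          of "\<lambda>w x. \<integral>\<^sup>+q. F (q + x\<^sup>2) w \<partial>chi_squared m"]) measurable
  also have "\<dots> = (\<integral>\<^sup>+w. \<integral>\<^sup>+q. F q w \<partial>chi_squared (Suc m) \<partial>std_normal)"
    by (subst nn_integral_chi_squared_Suc) simp_all
  finally show ?case .
qed

section \<open>Distribution function and quantiles of the chi-squared law\<close>

text \<open>This is a marginal of the joint law just found: the test function is constant in the
  projection, whose law has total mass one.\<close>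

lemma distr_residual:
  fixes u :: "nat \<Rightarrow> real"
  assumes u: "(\<Sum>i<Suc m. (u i)\<^sup>2) = 1"
  shows "distr (PiM {..<Suc m} (\<lambda>_. std_normal)) borel
    (\<lambda>X. (\<Sum>i<Suc m. (X i)\<^sup>2) - (\<Sum>i<Suc m. u i * X i)\<^sup>2) = chi_squared m"
proof (rule measure_eqI_nn_integral)
  fix F :: "real \<Rightarrow> ennreal"
  assume "F \<in> borel_measurable (chi_squared m)"
  then have [measurable]: "F \<in> borel_measurable borel" by simp
  show "(\<integral>\<^sup>+t. F t \<partial>distr (PiM {..<Suc m} (\<lambda>_. std_normal)) borel
    (\<lambda>X. (\<Sum>i<Suc m. (X i)\<^sup>2) - (\<Sum>i<Suc m. u i * X i)\<^sup>2)) = (\<integral>\<^sup>+t. F t \<partial>chi_squared m)"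
    using nn_integral_residual_projection[OF u, of "\<lambda>q w. F q"]
    by (subst nn_integral_distr) (simp_all add: std_normal.emeasure_space_1[simplified])
qed simp

section \<open>Absence of atoms and positivity of intervals\<close>

lemma null_sets_std_normal_iff:
  "A \<in> null_sets std_normal \<longleftrightarrow> A \<in> null_sets lborel"
proof -
  have "ennreal (std_normal_density x) \<noteq> 0" for x
    using normal_density_pos[of 1 0 x] by simp
  then have "A \<in> null_sets std_normal \<longleftrightarrow> A \<in> sets lborel \<and> (AE x in lborel. x \<notin> A)"
    by (simp add: null_sets_density_iff)
  also have "\<dots> \<longleftrightarrow> A \<in> null_sets lborel"
    using AE_iff_null_sets[of A lborel] null_setsD2[of A lborel] by blast
  finally show ?thesis .
qed

lemma emeasure_chi_squared_Suc:
  assumes [measurable]: "A \<in> sets borel"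
  shows "emeasure (chi_squared (Suc m)) A =
    (\<integral>\<^sup>+x. \<integral>\<^sup>+t. indicator A (t + x\<^sup>2) \<partial>chi_squared m \<partial>std_normal)"
  using nn_integral_chi_squared_Suc[of "indicator A" m] by simp

text \<open>Conditionally on the other squares, summing to \<open>q\<close>, the last variable must
  solve \<open>x\<^sup>2 = t - q\<close>, which has at most two solutions. One degree of freedom is
  required, since the law with none is the point mass at 0.\<close>

lemma emeasure_chi_squared_singleton: "emeasure (chi_squared (Suc m)) {t} = 0"
proof -
  interpret chi: prob_space "chi_squared m" by (rule prob_space_chi_squared)
  interpret pair_sigma_finite std_normal "chi_squared m" ..
  have null: "(\<integral>\<^sup>+x. indicator {t} (q + x\<^sup>2) \<partial>std_normal) = 0" for q :: real
  proof -
    have "{x. x\<^sup>2 = t - q} \<subseteq> {sqrt (t - q), - sqrt (t - q)}"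
      by (auto simp: real_sqrt_unique)
         (metis abs_minus_cancel abs_of_nonneg abs_of_nonpos linear minus_minus real_sqrt_abs)
    then have "finite {x. x\<^sup>2 = t - q}" by (rule finite_subset) simp
    then have "{x. x\<^sup>2 = t - q} \<in> null_sets std_normal"
      by (simp add: null_sets_std_normal_iff finite_imp_null_set_lborel)
    moreover have "(\<lambda>x. indicator {t} (q + x\<^sup>2) :: ennreal) = indicator {x. x\<^sup>2 = t - q}"
      by (auto simp: indicator_def fun_eq_iff)
    ultimately show ?thesis by (auto simp: null_sets_def)
  qed
  have "emeasure (chi_squared (Suc m)) {t} =
      (\<integral>\<^sup>+q. \<integral>\<^sup>+x. indicator {t} (q + x\<^sup>2) \<partial>std_normal \<partial>chi_squared m)"
    by (subst emeasure_chi_squared_Suc, simp, rule Fubini'[symmetric]) measurable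
  then show ?thesis by (simp add: null)
qed

lemma emeasure_std_normal_sq_pos:
  assumes "0 \<le> a" "a < b"
  shows "emeasure std_normal {x. a < x\<^sup>2 \<and> x\<^sup>2 < b} > 0"
proof -
  have "{sqrt a<..<sqrt b} \<subseteq> {x. a < x\<^sup>2 \<and> x\<^sup>2 < b}"
  proof
    fix x assume "x \<in> {sqrt a<..<sqrt b}"
    then have x: "sqrt a < x" "x < sqrt b" by auto
    have a: "0 \<le> sqrt a" using assms by simp
    have "0 \<le> x" using a x by linarith
    then have "(sqrt a)\<^sup>2 < x\<^sup>2" "x\<^sup>2 < (sqrt b)\<^sup>2"
      using power_strict_mono[OF x(1) a, of 2] power_strict_mono[OF x(2), of 2] by simp_all
    then show "x \<in> {x. a < x\<^sup>2 \<and> x\<^sup>2 < b}" using assms by simp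
  qed
  moreover have "{x. a < x\<^sup>2 \<and> x\<^sup>2 < b} \<in> sets std_normal" by simp
  moreover have "{sqrt a<..<sqrt b} \<notin> null_sets std_normal"
    unfolding null_sets_std_normal_iff using assms by (auto simp: null_sets_def)
  ultimately show ?thesis
    by (metis (no_types, lifting) greaterThanLessThan_borel null_setsI null_sets_subset
        sets_density sets_lborel zero_less_iff_neq_zero)
qed

lemma emeasure_chi_squared_interval_pos:
  assumes "emeasure (chi_squared m) {0..<(b - a) / 2} > 0" and ab: "0 \<le> a" "a < b"
  shows "emeasure (chi_squared (Suc m)) {a<..<b} > 0"
proof -
  \<comment> \<open>Half of the interval is reserved for each summand: \<open>x\<^sup>2\<close>
    strictly between \<open>a\<close> and \<open>b - d = a + d\<close>, and \<open>t\<close> in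
    \<open>{0..<d}\<close>, force \<open>t + x\<^sup>2\<close> into \<open>{a<..<b}\<close>. The two
    conditions are independent and both have positive probability.\<close>
  define d where "d = (b - a) / 2"
  have "0 < emeasure std_normal {x. a < x\<^sup>2 \<and> x\<^sup>2 < b - d} * emeasure (chi_squared m) {0..<d}"
    using assms emeasure_std_normal_sq_pos[of a "b - d"]
    by (simp add: d_def ennreal_zero_less_mult_iff field_simps)
  also have "\<dots> = (\<integral>\<^sup>+x. indicator {x. a < x\<^sup>2 \<and> x\<^sup>2 < b - d} x * emeasure (chi_squared m) {0..<d} \<partial>std_normal)"
    by (subst nn_integral_multc) auto
  also have "\<dots> = (\<integral>\<^sup>+x. \<integral>\<^sup>+t. indicator {x. a < x\<^sup>2 \<and> x\<^sup>2 < b - d} x * indicator {0..<d} t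
      \<partial>chi_squared m \<partial>std_normal)"
    by (subst nn_integral_cmult) auto
  also have "\<dots> \<le> (\<integral>\<^sup>+x. \<integral>\<^sup>+t. indicator {a<..<b} (t + x\<^sup>2) \<partial>chi_squared m \<partial>std_normal)"
    by (intro nn_integral_mono) (auto simp: indicator_def)
  also have "\<dots> = emeasure (chi_squared (Suc m)) {a<..<b}"
    by (subst emeasure_chi_squared_Suc) simp_all
  finally show ?thesis .
qed

text \<open>This supplies the first premise of the preceding lemma, by induction through that lemma
  with \<open>a = 0\<close>. The interval contains 0 so that the base case, the point mass at 0, is
  covered.\<close>

lemma emeasure_chi_squared_near_0_pos:
  assumes "0 < d"
  shows "emeasure (chi_squared m) {0..<d} > 0"
  using assms
proof (induction m arbitrary: d)
  case 0
  then show ?case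
    using nn_integral_chi_squared_0[of "indicator {0..<d}"] by simp
next
  case (Suc m)
  then have "0 < emeasure (chi_squared (Suc m)) {0<..<d}"
    by (intro emeasure_chi_squared_interval_pos) auto
  also have "\<dots> \<le> emeasure (chi_squared (Suc m)) {0..<d}"
    by (intro emeasure_mono) auto
  finally show ?case .
qed

section \<open>Monotonicity and inversion of the distribution function\<close>

lemma real_distribution_chi_squared: "real_distribution (chi_squared m)"
  by (simp add: real_distribution_def real_distribution_axioms_def prob_space_chi_squared)

lemma cdf_chi_squared_strict_mono:
  assumes "0 \<le> a" "a < b"
  shows "cdf (chi_squared (Suc m)) a < cdf (chi_squared (Suc m)) b"
proof -
  interpret real_distribution "chi_squared (Suc m)" by (rule real_distribution_chi_squared)
  have "0 < emeasure (chi_squared (Suc m)) {a<..<b}"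
    using assms by (intro emeasure_chi_squared_interval_pos emeasure_chi_squared_near_0_pos) auto
  then have "0 < measure (chi_squared (Suc m)) {a<..<b}"
    by (simp add: emeasure_eq_measure)
  also have "\<dots> \<le> measure (chi_squared (Suc m)) {a<..b}"
    by (intro finite_measure_mono) auto
  also have "\<dots> = cdf (chi_squared (Suc m)) b - cdf (chi_squared (Suc m)) a"
    using cdf_diff_eq[OF assms(2)] by simp
  finally show ?thesis by simp
qed

text \<open>Both arguments are taken nonnegative because the distribution function vanishes on the
  negative half-line and is not injective there.\<close>

lemma cdf_chi_squared_le_iff:
  assumes "0 \<le> a" "0 \<le> b"
  shows "cdf (chi_squared (Suc m)) a \<le> cdf (chi_squared (Suc m)) b \<longleftrightarrow> a \<le> b"
  using assms cdf_chi_squared_strict_mono[of a b m] cdf_chi_squared_strict_mono[of b a m]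
  by (cases a b rule: linorder_cases) auto

text \<open>Acceptance is a strict inequality, whereas \<open>cdf\<close> measures closed
  half-lines; without atoms the two agree.\<close>

lemma measure_chi_squared_lessThan:
  "measure (chi_squared (Suc m)) {..<t} = cdf (chi_squared (Suc m)) t"
proof -
  interpret real_distribution "chi_squared (Suc m)" by (rule real_distribution_chi_squared)
  have "cdf (chi_squared (Suc m)) t = measure (chi_squared (Suc m)) ({..<t} \<union> {t})"
    unfolding cdf_def by (intro arg_cong[where f="measure _"]) auto
  also have "\<dots> = measure (chi_squared (Suc m)) {..<t} + measure (chi_squared (Suc m)) {t}"
    by (rule finite_measure_Union) auto
  finally show ?thesis by (simp add: measure_def emeasure_chi_squared_singleton)
qed

text \<open>The open half-line below \<open>t\<close> may be measured instead, and no sum of squares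
  lies strictly below a nonpositive \<open>t\<close>. This includes \<open>t = 0\<close>.\<close>

lemma cdf_chi_squared_nonpos:
  assumes "t \<le> 0"
  shows "cdf (chi_squared (Suc m)) t = 0"
proof -
  have "emeasure (chi_squared (Suc m)) {..<t} = (\<integral>\<^sup>+x. indicator {..<t} x \<partial>chi_squared (Suc m))"
    by simp
  also have "\<dots> = (\<integral>\<^sup>+X. indicator {..<t} (\<Sum>i<Suc m. (X i)\<^sup>2) \<partial>PiM {..<Suc m} (\<lambda>_. std_normal))"
    by (rule nn_integral_chi_squared) simp
  also have "\<dots> = (\<integral>\<^sup>+X. 0 \<partial>PiM {..<Suc m} (\<lambda>_. std_normal))"
  proof (rule nn_integral_cong)
    fix X :: "nat \<Rightarrow> real"
    have "(\<Sum>i<Suc m. (X i)\<^sup>2) \<ge> 0" by (rule sum_nonneg) simp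
    then show "indicator {..<t} (\<Sum>i<Suc m. (X i)\<^sup>2) = (0 :: ennreal)"
      using assms by (simp add: indicator_def)
  qed
  finally show ?thesis
    by (simp add: measure_chi_squared_lessThan[symmetric] measure_def)
qed

text \<open>Intermediate value theorem between 0, where the function vanishes, and some
  \<open>b\<close> where it exceeds \<open>\<beta>\<close> because it tends to 1. Continuity is the
  absence of atoms.\<close>

lemma cdf_chi_squared_surj:
  assumes "0 < \<beta>" "\<beta> < 1"
  obtains q where "0 < q" "cdf (chi_squared (Suc m)) q = \<beta>"
proof -
  interpret real_distribution "chi_squared (Suc m)" by (rule real_distribution_chi_squared)
  have "eventually (\<lambda>x. \<beta> < cdf (chi_squared (Suc m)) x \<and> 0 < x) at_top"
    by (intro eventually_conj order_tendstoD(1)[OF cdf_lim_at_top_prob] eventually_gt_at_top) fact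
  then obtain b where b: "\<beta> < cdf (chi_squared (Suc m)) b" "0 < b"
    using eventually_happens'[OF trivial_limit_at_top_linorder] by blast
  have "isCont (cdf (chi_squared (Suc m))) x" for x
    by (simp add: isCont_cdf measure_def emeasure_chi_squared_singleton)
  then obtain q where "0 \<le> q" "cdf (chi_squared (Suc m)) q = \<beta>"
    using IVT[of "cdf (chi_squared (Suc m))" 0 \<beta> b] b assms cdf_chi_squared_nonpos[of 0 m] by auto
  moreover from this have "q \<noteq> 0" using assms cdf_chi_squared_nonpos[of 0 m] by auto
  ultimately show ?thesis by (intro that[of q]) auto
qed

lemma quantile_chi_squared:
  assumes "0 < \<beta>" "\<beta> < 1"
  shows quantile_chi_squared_pos: "0 < quantile (chi_squared (Suc m)) \<beta>"
    and cdf_quantile_chi_squared: "cdf (chi_squared (Suc m)) (quantile (chi_squared (Suc m)) \<beta>) = \<beta>"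
proof -
  obtain q where q: "0 < q" "cdf (chi_squared (Suc m)) q = \<beta>"
    using cdf_chi_squared_surj[OF assms] by blast
  \<comment> \<open>The set in the definition of \<open>quantile\<close> is exactly
    \<open>{q..}\<close>: negative \<open>x\<close> are excluded because the distribution function
    is 0 there and \<open>\<beta>\<close> is positive.\<close>
  have "\<beta> \<le> cdf (chi_squared (Suc m)) x \<longleftrightarrow> q \<le> x" for x
    using cdf_chi_squared_le_iff[of q x m] cdf_chi_squared_nonpos[of x m] q assms
    by (cases "0 \<le> x") auto
  then have "quantile (chi_squared (Suc m)) \<beta> = Inf {q..}"
    unfolding quantile_def by (intro arg_cong[where f=Inf]) auto
  then show "0 < quantile (chi_squared (Suc m)) \<beta>"
    "cdf (chi_squared (Suc m)) (quantile (chi_squared (Suc m)) \<beta>) = \<beta>"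
    using q by simp_all
qed

section \<open>The test statistic as a residual sum of squares\<close>

lemma moore_penrose_sym: "moore_penrose A B \<Longrightarrow> moore_penrose B A"
  unfolding moore_penrose_def by auto

lemma moore_penrose_projection:
  assumes P: "P \<in> carrier_mat n n" and "P * P = P" "P\<^sup>T = P"
  shows "moore_penrose P P"
  using assms by (auto simp: moore_penrose_def)

section \<open>Least squares on a single regressor\<close>

lemma sum_squares_diff:
  fixes d y :: "'i \<Rightarrow> real"
  shows "(\<Sum>i\<in>I. (y i - t * d i)\<^sup>2) =
    (\<Sum>i\<in>I. (y i)\<^sup>2) - 2 * t * (\<Sum>i\<in>I. d i * y i) + t\<^sup>2 * (\<Sum>i\<in>I. (d i)\<^sup>2)"
proof -
  have "(\<Sum>i\<in>I. (y i - t * d i)\<^sup>2) = (\<Sum>i\<in>I. (y i)\<^sup>2 - 2 * t * (d i * y i) + t\<^sup>2 * (d i)\<^sup>2)"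
    by (simp add: power2_eq_square algebra_simps)
  then show ?thesis by (simp add: sum.distrib sum_subtractf sum_distrib_left)
qed

text \<open>Completing the square shows a parabola with positive leading coefficient, whose vertex
  is given by the normal equation \<open>dy\<close>.\<close>

lemma mean_square_estimator_eq:
  assumes pos: "0 < (\<Sum>i=1..n. (drift_increment f \<Delta> i)\<^sup>2)"
  shows "mean_square_estimator f \<Delta> n x =
    (\<Sum>i=1..n. drift_increment f \<Delta> i * (x (real i * \<Delta>) - x ((real i - 1) * \<Delta>))) /
    (\<Sum>i=1..n. (drift_increment f \<Delta> i)\<^sup>2)" (is "_ = ?t")
proof -
  let ?d = "drift_increment f \<Delta>" and ?y = "\<lambda>i. x (real i * \<Delta>) - x ((real i - 1) * \<Delta>)"
  let ?D = "\<Sum>i=1..n. (?d i)\<^sup>2" and ?g = "\<lambda>\<theta>. \<Sum>i=1..n. (?y i - \<theta> * ?d i)\<^sup>2"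
  define t where "t = ?t"
  have dy: "(\<Sum>i=1..n. ?d i * ?y i) = t * ?D" using pos by (simp add: t_def)
  have g: "?g \<theta> = (\<Sum>i=1..n. (?y i)\<^sup>2) - 2 * \<theta> * (\<Sum>i=1..n. ?d i * ?y i) + \<theta>\<^sup>2 * ?D" for \<theta>
    by (rule sum_squares_diff)
  have complete_sq: "a - 2 * \<theta> * (t * D) + \<theta>\<^sup>2 * D = a - 2 * t * (t * D) + t\<^sup>2 * D + D * (\<theta> - t)\<^sup>2"
    for a \<theta> D :: real by (simp add: power2_eq_square algebra_simps)
  have sq: "?g \<theta> = ?g t + ?D * (\<theta> - t)\<^sup>2" for \<theta>
    unfolding g dy by (rule complete_sq)
  show ?thesis
    unfolding mean_square_estimator_def t_def[symmetric]
  \<comment> \<open>\<open>arg_min\<close> chooses some minimiser, so minimality of \<open>t\<close>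
    has to be accompanied by uniqueness.\<close>
  proof (rule arg_minI)
    fix \<theta> show "\<not> ?g \<theta> < ?g t" using sq[of \<theta>] pos by (simp add: not_less)
  next
    fix \<theta> assume "\<forall>y. True \<longrightarrow> \<not> ?g y < ?g \<theta>"
    then have "?g \<theta> \<le> ?g t" by (simp add: not_less)
    then have "?D * (\<theta> - t)\<^sup>2 \<le> 0" using sq[of \<theta>] by linarith
    then show "\<theta> = t" using pos by (simp add: mult_le_0_iff)
  qed simp
qed

section \<open>The hat matrix and the Gram matrix of \<open>C\<close>\<close>

lemma dim_hat_matrix: "hat_matrix f \<Delta> n \<in> carrier_mat n n"
  by (rule carrier_matI) (simp_all add: hat_matrix_def Let_def)

lemma hat_matrix_index:
  assumes "i < n" "j < n"
  shows "hat_matrix f \<Delta> n $$ (i, j) = drift_vector f \<Delta> n $ i * drift_vector f \<Delta> n $ j /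
    (\<Sum>l<n. (drift_vector f \<Delta> n $ l)\<^sup>2)"
  using assms
  by (simp add: hat_matrix_def Let_def scalar_prod_def mat_of_cols_def drift_vector_def
      power2_eq_square atLeast0LessThan divide_inverse)

lemma drift_vector_sum_squares:
  assumes "0 < \<Delta>"
  shows "(\<Sum>l<n. (drift_vector f \<Delta> n $ l)\<^sup>2) = (\<Sum>i=1..n. (drift_increment f \<Delta> i)\<^sup>2) / \<Delta>"
  using assms
  by (simp add: drift_vector_def power_divide sum_divide_distrib sum.atLeast1_atMost_eq)

text \<open>The Moore-Penrose relation is symmetric, so both the Gram matrix and the orthogonal
  projection itself are inverses of that projection; uniqueness identifies them.\<close>

lemma gram_eq_projection:
  assumes mp: "moore_penrose (C * C\<^sup>T) (1\<^sub>m n - hat_matrix f \<Delta> n)"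
    and pos: "0 < (\<Sum>l<n. (drift_vector f \<Delta> n $ l)\<^sup>2)" (is "0 < ?s")
  shows "C * C\<^sup>T = 1\<^sub>m n - hat_matrix f \<Delta> n"
proof -
  let ?H = "hat_matrix f \<Delta> n" and ?z = "\<lambda>i. drift_vector f \<Delta> n $ i"
  note H = dim_hat_matrix[of f \<Delta> n]
  \<comment> \<open>The matrix has rank one: the inner sum over \<open>l\<close> yields the squared
    norm \<open>?s\<close>, which cancels one of the two normalising factors.\<close>
  have HH: "?H * ?H = ?H"
  proof (rule eq_matI)
    fix i j assume ij: "i < dim_row ?H" "j < dim_col ?H"
    have "(?H * ?H) $$ (i, j) = (\<Sum>l<n. ?z i * ?z l / ?s * (?z l * ?z j / ?s))"
      using ij H by (simp add: scalar_prod_def hat_matrix_index atLeast0LessThan)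
    also have "\<dots> = ?z i * ?z j / ?s\<^sup>2 * ?s"
      by (simp only: sum_distrib_left) (simp add: power2_eq_square mult_ac)
    also have "\<dots> = ?H $$ (i, j)"
      using ij H pos by (simp add: hat_matrix_index power2_eq_square)
    finally show "(?H * ?H) $$ (i, j) = ?H $$ (i, j)" .
  qed (use H in auto)
  have HT: "?H\<^sup>T = ?H"
    using H by (intro eq_matI) (auto simp: hat_matrix_index)
  let ?P = "1\<^sub>m n - ?H"
  have P: "?P \<in> carrier_mat n n" using H by (rule minus_carrier_mat)
  have "?P * ?P = ?P * 1\<^sub>m n - ?P * ?H"
    using H by (intro mult_minus_distrib_mat) auto
  also have "?P * ?H = 1\<^sub>m n * ?H - ?H * ?H"
    using H by (intro minus_mult_distrib_mat) auto
  also have "\<dots> = 0\<^sub>m n n" using H by (simp add: HH)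
  also have "?P * 1\<^sub>m n - 0\<^sub>m n n = ?P"
    unfolding right_mult_one_mat[OF P] using H by (intro eq_matI) auto
  finally have PP: "?P * ?P = ?P" .
  have PT: "?P\<^sup>T = ?P"
    using H by (subst transpose_minus[of _ n n]) (auto simp: HT)
  show ?thesis
    using moore_penrose_unique[OF moore_penrose_sym[OF mp] moore_penrose_projection[OF P PP PT]] .
qed

lemma euclidean_norm_sq: "(euclidean_norm v)\<^sup>2 = v \<bullet> v"
  by (simp add: euclidean_norm_def L2_set_def sum_nonneg scalar_prod_def atLeast0LessThan power2_eq_square)

text \<open>Moving \<open>C\<close> across the scalar product shows that the norm depends on
  \<open>C\<close> only through its Gram matrix.\<close>

lemma euclidean_norm_gram:
  assumes C: "C \<in> carrier_mat n k" and v: "v \<in> carrier_vec n"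
  shows "(euclidean_norm (C\<^sup>T *\<^sub>v v))\<^sup>2 = v \<bullet> ((C * C\<^sup>T) *\<^sub>v v)"
proof -
  have Cv: "C\<^sup>T *\<^sub>v v \<in> carrier_vec k" using C v by auto
  have "(euclidean_norm (C\<^sup>T *\<^sub>v v))\<^sup>2 = v \<bullet> (C *\<^sub>v (C\<^sup>T *\<^sub>v v))"
    unfolding euclidean_norm_sq using transpose_vec_mult_scalar[OF C Cv v] by simp
  then show ?thesis using C v by simp
qed

text \<open>The least squares residuals are orthogonal to the drift vector, so the hat matrix
  annihilates them and the projection fixes them. What remains is the residual sum of squares,
  evaluated at the optimal \<open>t\<close>.\<close>

lemma test_statistic_eq:
  assumes C: "C \<in> carrier_mat n k"
    and mp: "moore_penrose (C * C\<^sup>T) (1\<^sub>m n - hat_matrix f \<Delta> n)"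
    and pos: "0 < (\<Sum>i=1..n. (drift_increment f \<Delta> i)\<^sup>2)" and \<Delta>: "0 < \<Delta>"
  defines "y \<equiv> \<lambda>x i. x (real (Suc i) * \<Delta>) - x (real i * \<Delta>)"
    and "d \<equiv> \<lambda>i. drift_increment f \<Delta> (Suc i)"
  shows "test_statistic f \<Delta> n C x =
    ((\<Sum>i<n. (y x i)\<^sup>2) - (\<Sum>i<n. d i * y x i)\<^sup>2 / (\<Sum>i<n. (d i)\<^sup>2)) / (\<Delta> * (real n - 1))"
proof -
  let ?H = "hat_matrix f \<Delta> n" and ?z = "drift_vector f \<Delta> n"
  let ?s = "\<Sum>i<n. (d i)\<^sup>2"
  define t where "t = (\<Sum>i<n. d i * y x i) / ?s"
  let ?v = "centered_increments f \<Delta> n x"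
  have s: "(\<Sum>i=1..n. (drift_increment f \<Delta> i)\<^sup>2) = ?s"
    by (simp add: sum.atLeast1_atMost_eq d_def)
  have pos': "0 < ?s" using pos s by simp
  have est: "mean_square_estimator f \<Delta> n x = t"
    unfolding mean_square_estimator_eq[OF pos]
    by (simp add: sum.atLeast1_atMost_eq d_def y_def t_def)
  have v: "?v \<in> carrier_vec n" by (simp add: centered_increments_def)
  have v_i: "?v $ i = (y x i - t * d i) / sqrt \<Delta>" if "i < n" for i
    using that by (simp add: centered_increments_def y_def d_def est)
  have z_i: "?z $ i = d i / sqrt \<Delta>" if "i < n" for i
    using that by (simp add: drift_vector_def d_def)
  have zpos: "0 < (\<Sum>l<n. (?z $ l)\<^sup>2)"
    using pos \<Delta> by (simp add: drift_vector_sum_squares)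
  have dy: "(\<Sum>i<n. d i * y x i) = t * ?s" using pos' by (simp add: t_def)
  have "?z $ j * ?v $ j = (d j * y x j - t * (d j)\<^sup>2) / \<Delta>" if "j < n" for j
  proof -
    have "?z $ j * ?v $ j = d j * (y x j - t * d j) / (sqrt \<Delta> * sqrt \<Delta>)"
      using that by (simp only: z_i v_i times_divide_times_eq)
    then show ?thesis using \<Delta> by (simp add: power2_eq_square algebra_simps)
  qed
  \<comment> \<open>Orthogonality of residuals and regressor is the normal equation
    \<open>dy\<close> divided by \<open>\<Delta>\<close>.\<close>
  then have "(\<Sum>j<n. ?z $ j * ?v $ j) = (\<Sum>j<n. d j * y x j - t * (d j)\<^sup>2) / \<Delta>"
    by (simp add: sum_divide_distrib)
  also have "\<dots> = 0"
    by (simp add: sum_subtractf sum_distrib_left[symmetric] dy)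
  finally have zv: "(\<Sum>j<n. ?z $ j * ?v $ j) = 0" .
  have "?H *\<^sub>v ?v = 0\<^sub>v n"
  proof (rule eq_vecI)
    fix i assume "i < dim_vec (0\<^sub>v n :: real vec)"
    then have i: "i < n" by simp
    have "(?H *\<^sub>v ?v) $ i = (\<Sum>j<n. ?z $ i / (\<Sum>l<n. (?z $ l)\<^sup>2) * (?z $ j * ?v $ j))"
      using i v dim_hat_matrix[of f \<Delta> n]
      by (simp add: scalar_prod_def hat_matrix_index atLeast0LessThan mult.assoc)
    then show "(?H *\<^sub>v ?v) $ i = 0\<^sub>v n $ i" using i by (simp only: sum_distrib_left[symmetric] zv) simp
  qed (use dim_hat_matrix[of f \<Delta> n] in auto)
  then have "(1\<^sub>m n - ?H) *\<^sub>v ?v = ?v"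
    using v dim_hat_matrix[of f \<Delta> n] by (subst minus_mult_distrib_mat_vec[of _ n n]) auto
  then have "(euclidean_norm (C\<^sup>T *\<^sub>v ?v))\<^sup>2 = (\<Sum>i<n. (?v $ i)\<^sup>2)"
    using v unfolding euclidean_norm_gram[OF C v] gram_eq_projection[OF mp zpos]
    by (simp add: scalar_prod_def atLeast0LessThan power2_eq_square)
  also have "\<dots> = (\<Sum>i<n. (y x i - t * d i)\<^sup>2) / \<Delta>"
    using \<Delta> by (simp add: sum_divide_distrib v_i power_divide)
  also have "(\<Sum>i<n. (y x i - t * d i)\<^sup>2) = (\<Sum>i<n. (y x i)\<^sup>2) - (\<Sum>i<n. d i * y x i)\<^sup>2 / ?s"
    using pos' unfolding sum_squares_diff dy by (simp add: power2_eq_square field_simps)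
  finally show ?thesis by (simp add: test_statistic_def)
qed

section \<open>The law of the test statistic\<close>

text \<open>Each increment has variance \<open>\<Delta>\<close>, so division by
  \<open>sqrt \<Delta>\<close> standardises it; independence turns the joint law into the product
  law. The dimension is a successor so that the index set is nonempty.\<close>

lemma brownian_increments_distr:
  assumes bm: "brownian_motion M W" and \<Delta>: "0 < \<Delta>"
  defines "G \<equiv> \<lambda>i \<omega>. (W (real (Suc i) * \<Delta>) \<omega> - W (real i * \<Delta>) \<omega>) / sqrt \<Delta>"
  shows "distr M (PiM {..<Suc m} (\<lambda>_. borel)) (\<lambda>\<omega>. \<lambda>i\<in>{..<Suc m}. G i \<omega>) =
    PiM {..<Suc m} (\<lambda>_. std_normal)"
proof -
  interpret prob_space M using bm by (simp add: brownian_motion_def)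
  have W [measurable]: "W (real i * \<Delta>) \<in> borel_measurable M" for i :: nat
    using bm \<Delta> by (simp add: brownian_motion_def)
  have G [measurable]: "G i \<in> borel_measurable M" for i
    unfolding G_def by measurable
  have "distributed M lborel (\<lambda>\<omega>. W (real (Suc i) * \<Delta>) \<omega> - W (real i * \<Delta>) \<omega>)
      (normal_density 0 (sqrt (real (Suc i) * \<Delta> - real i * \<Delta>)))" for i
    using bm \<Delta> unfolding brownian_motion_def by auto
  then have "distributed M lborel (\<lambda>\<omega>. W (real (Suc i) * \<Delta>) \<omega> - W (real i * \<Delta>) \<omega>)
      (normal_density 0 (sqrt \<Delta>))" for i
    by (simp add: algebra_simps)
  then have "distributed M lborel (G i) std_normal_density" for i
    using normal_standard_normal_convert[of "sqrt \<Delta>" _ 0] \<Delta> by (simp add: G_def)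
  then have law: "distr M borel (G i) = std_normal" for i
    using distributed_distr_eq_density[of M lborel "G i"]
    by (metis (no_types, lifting) distr_cong sets_lborel)
  \<comment> \<open>The last clause of \<open>brownian_motion\<close>, taken on the observation grid
    \<open>real i * \<Delta>\<close>.\<close>
  have "indep_vars (\<lambda>_. borel) (\<lambda>i \<omega>. W (real (Suc i) * \<Delta>) \<omega> - W (real i * \<Delta>) \<omega>) {..<Suc m}"
    using bm[unfolded brownian_motion_def, THEN conjunct2, THEN conjunct2, THEN conjunct2,
        THEN conjunct2, THEN conjunct2, rule_format, of "\<lambda>i. real i * \<Delta>" "Suc m"] \<Delta>
    by simp
  then have "indep_vars (\<lambda>_. borel) (\<lambda>i \<omega>. (\<lambda>x. x / sqrt \<Delta>)
      (W (real (Suc i) * \<Delta>) \<omega> - W (real i * \<Delta>) \<omega>)) {..<Suc m}"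
    by (rule indep_vars_compose2) measurable
  then have "indep_vars (\<lambda>_. borel) G {..<Suc m}" by (simp add: G_def)
  then show ?thesis
    by (subst (asm) indep_vars_iff_distr_eq_PiM') (simp_all add: law lessThan_empty_iff)
qed

section \<open>From the integrated equation to observed increments\<close>

lemma set_lebesgue_integral_combine:
  fixes f :: "real \<Rightarrow> real"
  assumes f: "f absolutely_integrable_on {a..c}" and "a \<le> b" "b \<le> c"
  shows "(LINT s:{a..c}|lebesgue. f s) = (LINT s:{a..b}|lebesgue. f s) + (LINT s:{b..c}|lebesgue. f s)"
proof -
  have "f absolutely_integrable_on {a..b}" "f absolutely_integrable_on {b..c}"
    using assms by (auto intro: absolutely_integrable_on_subinterval)
  then show ?thesis
    using Henstock_Kurzweil_Integration.integral_combine[where f=f, OF assms(2,3)] f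
    by (simp add: set_lebesgue_integral_eq_integral)
qed

lemma sde_solution_increment:
  assumes sol: "\<forall>t\<in>{0..T}. X t = x0 + \<theta> * (LINT s:{0..t}|lebesgue. f s) + \<sigma> * W t"
    and f: "f absolutely_integrable_on {0..T}"
    and T: "real n * \<Delta> = T" and \<Delta>: "0 < \<Delta>" and i: "i < n"
  shows "X (real (Suc i) * \<Delta>) - X (real i * \<Delta>) =
    \<theta> * drift_increment f \<Delta> (Suc i) + \<sigma> * (W (real (Suc i) * \<Delta>) - W (real i * \<Delta>))"
proof -
  let ?a = "real i * \<Delta>" and ?b = "real (Suc i) * \<Delta>"
  have "real (Suc i) \<le> real n" using i by linarith
  then have b: "?b \<le> T" unfolding T[symmetric] using \<Delta> by (intro mult_right_mono) auto
  have a: "0 \<le> ?a" "?a \<le> ?b" using \<Delta> by (auto intro: mult_right_mono)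
  have "f absolutely_integrable_on {0..?b}"
    using f by (rule absolutely_integrable_on_subinterval) (use b in auto)
  \<comment> \<open>The lower limit in \<open>drift_increment f \<Delta> (Suc i)\<close> is
    \<open>(real (Suc i) - 1) * \<Delta>\<close>, which equals \<open>?a\<close>.\<close>
  then have "(LINT s:{0..?b}|lebesgue. f s) = (LINT s:{0..?a}|lebesgue. f s) + drift_increment f \<Delta> (Suc i)"
    unfolding drift_increment_def using a by (subst set_lebesgue_integral_combine[where b="?a"]) simp_all
  moreover have "X ?a = x0 + \<theta> * (LINT s:{0..?a}|lebesgue. f s) + \<sigma> * W ?a"
    "X ?b = x0 + \<theta> * (LINT s:{0..?b}|lebesgue. f s) + \<sigma> * W ?b"
    using sol a b by auto
  ultimately show ?thesis by (simp add: algebra_simps)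
qed

text \<open>The residual sum of squares of the increments is unaffected by the drift, which is
  proportional to the regressor \<open>d\<close>.\<close>

lemma residual_sum_squares_shift:
  fixes d g :: "'i \<Rightarrow> real"
  assumes "(\<Sum>i\<in>I. (d i)\<^sup>2) \<noteq> 0"
  shows "(\<Sum>i\<in>I. (\<theta> * d i + s * g i)\<^sup>2) - (\<Sum>i\<in>I. d i * (\<theta> * d i + s * g i))\<^sup>2 / (\<Sum>i\<in>I. (d i)\<^sup>2) =
    s\<^sup>2 * ((\<Sum>i\<in>I. (g i)\<^sup>2) - (\<Sum>i\<in>I. d i * g i)\<^sup>2 / (\<Sum>i\<in>I. (d i)\<^sup>2))"
proof -
  let ?D = "\<Sum>i\<in>I. (d i)\<^sup>2" and ?p = "\<Sum>i\<in>I. d i * g i" and ?g = "\<Sum>i\<in>I. (g i)\<^sup>2"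
  have "(\<Sum>i\<in>I. (\<theta> * d i + s * g i)\<^sup>2) = (\<Sum>i\<in>I. \<theta>\<^sup>2 * (d i)\<^sup>2 + 2 * \<theta> * s * (d i * g i) + s\<^sup>2 * (g i)\<^sup>2)"
    by (simp add: power2_eq_square algebra_simps)
  also have "\<dots> = \<theta>\<^sup>2 * ?D + 2 * \<theta> * s * ?p + s\<^sup>2 * ?g"
    by (simp add: sum.distrib sum_distrib_left)
  finally have 1: "(\<Sum>i\<in>I. (\<theta> * d i + s * g i)\<^sup>2) = \<theta>\<^sup>2 * ?D + 2 * \<theta> * s * ?p + s\<^sup>2 * ?g" .
  have "(\<Sum>i\<in>I. d i * (\<theta> * d i + s * g i)) = (\<Sum>i\<in>I. \<theta> * (d i)\<^sup>2 + s * (d i * g i))"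
    by (simp add: power2_eq_square algebra_simps)
  then have 2: "(\<Sum>i\<in>I. d i * (\<theta> * d i + s * g i)) = \<theta> * ?D + s * ?p"
    by (simp add: sum.distrib sum_distrib_left)
  show ?thesis unfolding 1 2 using assms by (simp add: power2_eq_square field_simps)
qed

text \<open>Almost surely the rescaled statistic is the squared length of a standard Gaussian vector
  after removal of its component along the unit vector \<open>u\<close>, so
  \<open>distr_residual\<close> applies.\<close>

lemma test_statistic_distr:
  assumes C: "C \<in> carrier_mat n k"
    and mp: "moore_penrose (C * C\<^sup>T) (1\<^sub>m n - hat_matrix f \<Delta> n)"
    and pos: "0 < (\<Sum>i=1..n. (drift_increment f \<Delta> i)\<^sup>2)" and \<Delta>: "0 < \<Delta>"
    and n: "n \<ge> 2" and T: "real n * \<Delta> = T" and f: "f absolutely_integrable_on {0..T}"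
    and sol: "sde_solution M W X f T x0 \<theta> \<sigma>" and \<sigma>: "\<sigma>\<^sup>2 > 0"
  shows test_statistic_measurable: "(\<lambda>\<omega>. test_statistic f \<Delta> n C (\<lambda>t. X t \<omega>)) \<in> borel_measurable M"
    and distr_test_statistic:
      "distr M borel (\<lambda>\<omega>. (real n - 1) / \<sigma>\<^sup>2 * test_statistic f \<Delta> n C (\<lambda>t. X t \<omega>)) = chi_squared (n - 1)"
proof -
  let ?S = "\<lambda>\<omega>. test_statistic f \<Delta> n C (\<lambda>t. X t \<omega>)"
  have bm: "brownian_motion M W" using sol by (simp add: sde_solution_def)
  interpret prob_space M using bm by (simp add: brownian_motion_def)
  have "real i * \<Delta> \<in> {0..T}" if "i \<le> n" for i
    using that \<Delta> unfolding T[symmetric] by (auto intro!: mult_right_mono)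
  then have [measurable]: "X (real i * \<Delta>) \<in> borel_measurable M" if "i \<le> n" for i
    using sol that unfolding sde_solution_def by blast
  \<comment> \<open>Measurability is read off the closed formula, in which \<open>arg_min\<close> no
    longer occurs.\<close>
  show [measurable]: "?S \<in> borel_measurable M"
    unfolding test_statistic_eq[OF C mp pos \<Delta>] by (measurable; simp)
  obtain m where nm: "n = Suc m" using n by (cases n) auto
  define d where "d i = drift_increment f \<Delta> (Suc i)" for i
  define D where "D = (\<Sum>i<n. (d i)\<^sup>2)"
  define u where "u i = d i / sqrt D" for i
  define G where "G i \<omega> = (W (real (Suc i) * \<Delta>) \<omega> - W (real i * \<Delta>) \<omega>) / sqrt \<Delta>" for i \<omega>
  define R where "R g = (\<Sum>i<n. (g i)\<^sup>2) - (\<Sum>i<n. u i * g i)\<^sup>2" for g :: "nat \<Rightarrow> real"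
  have D: "D > 0" using pos by (simp add: D_def d_def sum.atLeast1_atMost_eq)
  have u: "(\<Sum>i<n. (u i)\<^sup>2) = 1"
    using D by (simp add: u_def power_divide sum_divide_distrib[symmetric] D_def[symmetric])
  have R_eq: "R g = (\<Sum>i<n. (g i)\<^sup>2) - (\<Sum>i<n. d i * g i)\<^sup>2 / D" for g
    using D by (simp add: R_def u_def sum_divide_distrib[symmetric] power_divide)
  have G_meas [measurable]: "G i \<in> borel_measurable M" for i
    using bm \<Delta> unfolding G_def by (auto simp: brownian_motion_def intro!: borel_measurable_divide borel_measurable_diff)
  have "AE \<omega> in M. \<forall>t\<in>{0..T}. X t \<omega> = x0 + \<theta> * (LINT s:{0..t}|lebesgue. f s) + \<sigma> * W t \<omega>"
    using sol by (simp add: sde_solution_def)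
  then have "AE \<omega> in M. (real n - 1) / \<sigma>\<^sup>2 * ?S \<omega> = R (\<lambda>i. G i \<omega>)"
  proof eventually_elim
    case (elim \<omega>)
    have "X (real (Suc i) * \<Delta>) \<omega> - X (real i * \<Delta>) \<omega> = \<theta> * d i + (\<sigma> * sqrt \<Delta>) * G i \<omega>" if "i < n" for i
      using sde_solution_increment[OF elim f T \<Delta> that] \<Delta> by (simp add: d_def G_def)
    then have "?S \<omega> = ((\<Sum>i<n. (\<theta> * d i + (\<sigma> * sqrt \<Delta>) * G i \<omega>)\<^sup>2) -
        (\<Sum>i<n. d i * (\<theta> * d i + (\<sigma> * sqrt \<Delta>) * G i \<omega>))\<^sup>2 / (\<Sum>i<n. (d i)\<^sup>2)) / (\<Delta> * (real n - 1))"
      unfolding test_statistic_eq[OF C mp pos \<Delta>] d_def[symmetric] by simp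
    \<comment> \<open>The drift drops out, and the factor is
      \<open>\<sigma>\<^sup>2 * \<Delta>\<close>: \<open>\<Delta>\<close> cancels against the
      denominator and \<open>\<sigma>\<^sup>2\<close> against the rescaling. Only the square of
      \<open>\<sigma>\<close> enters, so its sign is free.\<close>
    also have "\<dots> = (\<sigma> * sqrt \<Delta>)\<^sup>2 * R (\<lambda>i. G i \<omega>) / (\<Delta> * (real n - 1))"
      using D by (subst residual_sum_squares_shift) (simp_all add: D_def R_eq)
    finally show ?case using \<Delta> \<sigma> n by (simp add: power_mult_distrib)
  qed
  moreover have [measurable]: "(\<lambda>\<omega>. R (\<lambda>i. G i \<omega>)) \<in> borel_measurable M"
    unfolding R_def by measurable
  ultimately have "distr M borel (\<lambda>\<omega>. (real n - 1) / \<sigma>\<^sup>2 * ?S \<omega>) = distr M borel (\<lambda>\<omega>. R (\<lambda>i. G i \<omega>))"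
    by (intro distr_cong_AE) auto
  \<comment> \<open>\<open>R\<close> reads only coordinates below \<open>n\<close>, so it may be
    applied to the restricted family, an element of the product space.\<close>
  also have "\<dots> = distr M borel (R \<circ> (\<lambda>\<omega>. \<lambda>i\<in>{..<n}. G i \<omega>))"
    by (intro distr_cong) (auto simp: R_def)
  also have "\<dots> = distr (distr M (PiM {..<n} (\<lambda>_. borel)) (\<lambda>\<omega>. \<lambda>i\<in>{..<n}. G i \<omega>)) borel R"
    unfolding R_def by (subst distr_distr) measurable
  also have "\<dots> = distr (PiM {..<n} (\<lambda>_. std_normal)) borel R"
    using brownian_increments_distr[OF bm \<Delta>, of m] by (simp add: nm G_def)
  also have "\<dots> = chi_squared (n - 1)"
    using distr_residual[of u m] u unfolding R_def nm by simp
  finally show "distr M borel (\<lambda>\<omega>. (real n - 1) / \<sigma>\<^sup>2 * ?S \<omega>) = chi_squared (n - 1)" .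
qed

section \<open>Acceptance and rejection probabilities\<close>

lemma prob_test_accepts:
  assumes C: "C \<in> carrier_mat n k"
    and mp: "moore_penrose (C * C\<^sup>T) (1\<^sub>m n - hat_matrix f \<Delta> n)"
    and pos: "0 < (\<Sum>i=1..n. (drift_increment f \<Delta> i)\<^sup>2)" and \<Delta>: "0 < \<Delta>"
    and n: "n \<ge> 2" and T: "real n * \<Delta> = T" and f: "f absolutely_integrable_on {0..T}"
    and sol: "sde_solution M W X f T x0 \<theta> \<sigma>" and \<sigma>: "\<sigma>\<^sup>2 > 0"
  shows prob_accepts: "measure M {\<omega> \<in> space M. test_accepts f \<Delta> n C v0 \<alpha> (\<lambda>t. X t \<omega>)} =
      cdf (chi_squared (n - 1)) (v0 * quantile (chi_squared (n - 1)) (1 - \<alpha>) / \<sigma>\<^sup>2)" (is "_ = cdf _ ?c")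
    and prob_rejects: "measure M {\<omega> \<in> space M. test_rejects f \<Delta> n C v0 \<alpha> (\<lambda>t. X t \<omega>)} =
      1 - measure M {\<omega> \<in> space M. test_accepts f \<Delta> n C v0 \<alpha> (\<lambda>t. X t \<omega>)}"
proof -
  let ?S = "\<lambda>\<omega>. test_statistic f \<Delta> n C (\<lambda>t. X t \<omega>)"
  interpret prob_space M using sol by (simp add: sde_solution_def brownian_motion_def)
  note [measurable] = test_statistic_measurable[OF assms]
  have "x < v / N * q \<longleftrightarrow> N / w * x < v * q / w" if "0 < N" "0 < w" for x v N q w :: real
  proof -
    have "x < v / N * q \<longleftrightarrow> N * x < v * q" using that by (simp add: field_simps)
    also have "\<dots> \<longleftrightarrow> N / w * x < v * q / w" using that by (simp add: divide_less_cancel)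
    finally show ?thesis .
  qed
  then have "test_accepts f \<Delta> n C v0 \<alpha> (\<lambda>t. X t \<omega>) \<longleftrightarrow> (real n - 1) / \<sigma>\<^sup>2 * ?S \<omega> < ?c" for \<omega>
    using n \<sigma> by (simp add: test_rejects_def critical_value_def not_le)
  then have "measure M {\<omega> \<in> space M. test_accepts f \<Delta> n C v0 \<alpha> (\<lambda>t. X t \<omega>)} =
      measure (distr M borel (\<lambda>\<omega>. (real n - 1) / \<sigma>\<^sup>2 * ?S \<omega>)) {..<?c}"
    by (subst measure_distr) (auto intro!: arg_cong[where f="measure M"])
  also have "\<dots> = cdf (chi_squared (n - 1)) ?c"
  proof -
    \<comment> \<open>There is at least one degree of freedom, so the law has no atom at the
      threshold.\<close>
    have "Suc (n - 2) = n - 1" using n by simp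
    then show ?thesis
      unfolding distr_test_statistic[OF assms] by (metis measure_chi_squared_lessThan)
  qed
  finally show "measure M {\<omega> \<in> space M. test_accepts f \<Delta> n C v0 \<alpha> (\<lambda>t. X t \<omega>)} =
      cdf (chi_squared (n - 1)) ?c" .
  show "measure M {\<omega> \<in> space M. test_rejects f \<Delta> n C v0 \<alpha> (\<lambda>t. X t \<omega>)} =
      1 - measure M {\<omega> \<in> space M. test_accepts f \<Delta> n C v0 \<alpha> (\<lambda>t. X t \<omega>)}"
    by (subst prob_neg) (auto simp: test_rejects_def)
qed

theorem proposition3:
  fixes f :: "real \<Rightarrow> real" and \<Delta> T \<alpha> \<sigma>\<^sub>0 :: real and n k :: nat and C :: "real mat"
  assumes n: "n \<ge> 2"
    and \<Delta>: "\<Delta> > 0"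
    and T: "real n * \<Delta> = T"
    and f_integrable: "f absolutely_integrable_on {0..T}"
    and f_nondegenerate: "(\<Sum>i=1..n. (drift_increment f \<Delta> i)\<^sup>2) > 0"
    and C: "C \<in> carrier_mat n k"
    and C_mp: "moore_penrose (C * C\<^sup>T) (1\<^sub>m n - hat_matrix f \<Delta> n)"
    and \<alpha>: "\<alpha> \<in> {0<..<1}"
    and \<sigma>\<^sub>0: "\<sigma>\<^sub>0\<^sup>2 > 0"
  shows
    "(\<forall>(M :: 'a measure) W X x0 \<theta> \<sigma>. sde_solution M W X f T x0 \<theta> \<sigma> \<and> \<sigma>\<^sup>2 = \<sigma>\<^sub>0\<^sup>2 \<longrightarrow>
        measure M {\<omega> \<in> space M. test_rejects f \<Delta> n C (\<sigma>\<^sub>0\<^sup>2) \<alpha> (\<lambda>t. X t \<omega>)} = \<alpha>) \<and>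
     (\<forall>(M :: 'a measure) W X x0 \<theta> \<sigma>. sde_solution M W X f T x0 \<theta> \<sigma> \<and> \<sigma>\<^sup>2 = \<sigma>\<^sub>0\<^sup>2 \<longrightarrow>
        measure M {\<omega> \<in> space M. test_rejects f \<Delta> n C (\<sigma>\<^sub>0\<^sup>2) \<alpha> (\<lambda>t. X t \<omega>)} \<le> \<alpha>) \<and>
     (\<forall>\<beta>\<in>{0<..<1}. 1 - \<beta> \<ge> \<alpha> \<longrightarrow>
        (\<forall>(M :: 'a measure) W X x0 \<theta> \<sigma>. sde_solution M W X f T x0 \<theta> \<sigma> \<and> \<sigma>\<^sup>2 > 0 \<longrightarrow>
           (measure M {\<omega> \<in> space M. test_accepts f \<Delta> n C (\<sigma>\<^sub>0\<^sup>2) \<alpha> (\<lambda>t. X t \<omega>)} \<le> \<beta> \<longleftrightarrow>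
            \<sigma>\<^sup>2 \<ge> \<sigma>\<^sub>0\<^sup>2 * (quantile (chi_squared (n - 1)) (1 - \<alpha>) /
                        quantile (chi_squared (n - 1)) \<beta>))))"
proof -
  obtain m where m: "n - 1 = Suc m" using n by (cases "n - 1") auto
  let ?q = "quantile (chi_squared (n - 1))"
  note q_pos = quantile_chi_squared_pos[of _ m, folded m]
    and cdf_q = cdf_quantile_chi_squared[of _ m, folded m]
  note prob = prob_test_accepts[OF C C_mp f_nondegenerate \<Delta> n T f_integrable]
  \<comment> \<open>Under the null hypothesis the variance ratio is 1, so the acceptance probability
    is the distribution function at its own quantile, namely \<open>1 - \<alpha>\<close>.\<close>
  have size: "measure M {\<omega> \<in> space M. test_rejects f \<Delta> n C (\<sigma>\<^sub>0\<^sup>2) \<alpha> (\<lambda>t. X t \<omega>)} = \<alpha>"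
    if "sde_solution M W X f T x0 \<theta> \<sigma>" "\<sigma>\<^sup>2 = \<sigma>\<^sub>0\<^sup>2" for M :: "'a measure" and W X x0 \<theta> \<sigma>
    using prob[OF that(1), of "\<sigma>\<^sub>0\<^sup>2" \<alpha>] that(2) \<sigma>\<^sub>0 \<alpha> cdf_q[of "1 - \<alpha>"] by simp
  have power: "measure M {\<omega> \<in> space M. test_accepts f \<Delta> n C (\<sigma>\<^sub>0\<^sup>2) \<alpha> (\<lambda>t. X t \<omega>)} \<le> \<beta> \<longleftrightarrow>
      \<sigma>\<^sub>0\<^sup>2 * (?q (1 - \<alpha>) / ?q \<beta>) \<le> \<sigma>\<^sup>2"
    if "\<beta> \<in> {0<..<1}" "sde_solution M W X f T x0 \<theta> \<sigma>" "\<sigma>\<^sup>2 > 0"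
    for \<beta> \<sigma> x0 \<theta> and M :: "'a measure" and W X
  proof -
    have pos: "0 < ?q (1 - \<alpha>)" "0 < ?q \<beta>" using q_pos \<alpha> that(1) by auto
    \<comment> \<open>Writing \<open>\<beta>\<close> as the distribution function at its quantile
      turns the bound into a comparison of two values at nonnegative points, where strict
      monotonicity gives an equivalence.\<close>
    have "measure M {\<omega> \<in> space M. test_accepts f \<Delta> n C (\<sigma>\<^sub>0\<^sup>2) \<alpha> (\<lambda>t. X t \<omega>)} \<le> \<beta> \<longleftrightarrow>
        cdf (chi_squared (n - 1)) (\<sigma>\<^sub>0\<^sup>2 * ?q (1 - \<alpha>) / \<sigma>\<^sup>2) \<le> cdf (chi_squared (n - 1)) (?q \<beta>)"
      using prob(1)[OF that(2,3), of "\<sigma>\<^sub>0\<^sup>2" \<alpha>] cdf_q[of \<beta>] that(1) by simp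
    also have "\<dots> \<longleftrightarrow> \<sigma>\<^sub>0\<^sup>2 * ?q (1 - \<alpha>) / \<sigma>\<^sup>2 \<le> ?q \<beta>"
      using pos unfolding m by (intro cdf_chi_squared_le_iff) auto
    also have "\<dots> \<longleftrightarrow> \<sigma>\<^sub>0\<^sup>2 * (?q (1 - \<alpha>) / ?q \<beta>) \<le> \<sigma>\<^sup>2"
      using pos that(3) by (simp add: field_simps)
    finally show ?thesis .
  qed
  show ?thesis using size power by (intro conjI allI impI ballI) (auto simp only: order_refl)
qed

end
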